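(* Let $\Gamma$ be a weighted digraph with forest dimension $v$ and let $K$ be an undominated knot of $\Gamma$. Let $Q_{n-v}=(q^{n-v}_{ij})$ be its matrix of maximum out forests. Then: 1. For every $i\in V(\Gamma)$, $\sum_{j=1}^n q^{n-v}_{ij}=\varepsilon(\mathcal F_{n-v})$. 2. $q^{n-v}_{ij}\neq0$ if and only if $j\in\tilde K$ and $i$ is reachable from $j$ in $\Gamma$. 3. If $j\in K$, then for every $i\in V(\Gamma)$, $q^{n-v}_{ij}=\varepsilon(\mathcal T^j)\,\varepsilon(\mathcal P^{K\to i})$; moreover, if $i\in K^+$, then $q^{n-v}_{ij}=q^{n-v}_{jj}=\varepsilon(\mathcal T^j)\,\varepsilon(\mathcal P)$. 4. $\sum_{j\in K}q^{n-v}_{jj}=\varepsilon(\mathcal F_{n-v})$; in particular, if $j$ is an undominated vertex then $q^{n-v}_{jj}=\varepsilon(\mathcal F_{n-v})$. 5. If $j_1,j_2\in K$, then the $j_2$-th column of $Q_{n-v}$ equals $\bigl(\varepsilon(\mathcal T^{j_2})/\varepsilon(\mathcal T^{j_1})\bigr)$ times its $j_1$-th column.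
   Context: $\Gamma$: loopless digraph on $V(\Gamma)=\{1,\dots,n\}$, $n>1$, arc weights $\varepsilon_{ij}>0$. Weight of a subgraph = product of its arc weights (1 if no arcs); weight of a set of subgraphs = sum of weights (0 if empty). A vertex $w$ is reachable from $z$ if $w=z$ or there is a directed path from $z$ to $w$. A vertex is undominated if its indegree is 0, dominated otherwise. A diverging forest is a digraph without circuits with all indegrees $\le1$; its roots are the indegree-0 vertices; each weak component is a tree diverging from a root. A maximum out forest of $\Gamma$ is a spanning diverging forest of $\Gamma$ with the maximum number of arcs; the forest dimension $v$ is its number of roots. $\mathcal F_k$: spanning diverging forests of $\Gamma$ with $k$ arcs; $\mathcal F_k^{j\to i}$: those in which $i$ lies in the tree rooted at $j$. $Q_{n-v}=(q^{n-v}_{ij})$, $q^{n-v}_{ij}=\varepsilon(\mathcal F^{j\to i}_{n-v})$. An undominated knot is a nonempty $K\subseteq V(\Gamma)$ whose vertices are mutually reachable and such that there is no arc from a vertex outside $K$ to a vertex of $K$. $\tilde K$ is the union of all undominated knots; $K^+$ is the set of vertices reachable from $K$ and unreachable from every other undominated knot. $\Gamma_K$ is the restriction (induced subgraph) of $\Gamma$ to $K$, and $\Gamma_{-K}$ is the spanning subgraph with arc set $E(\Gamma)\setminus E(\Gamma_K)$. $\mathcal T$ is the set of spanning diverging trees of $\Gamma_K$, $\mathcal T^j$ those diverging from $j\in K$; $\mathcal P$ is the set of maximum out forests of $\Gamma_{-K}$, and $\mathcal P^{K\to i}$ those in which $i$ is reachable from some vertex of $K$. *)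

theory Defs
  imports "HOL-Analysis.Cartesian_Space" "Graph_Theory.Graph_Theory"
begin

text \<open>
  Digraphs are those of Graph_Theory: \<^locale>\<open>digraph\<close> means finite, loopless and without
  parallel arcs, and \<^const>\<open>forest\<close> means without directed circuits.  Since an arc is
  determined by its endpoints, weights are given on pairs of vertices: \<open>\<epsilon> i j\<close> is the
  weight of the arc from \<open>i\<close> to \<open>j\<close>, and its values on non-arcs play no role.
\<close>

definition weight :: "('a \<Rightarrow> 'a \<Rightarrow> real) \<Rightarrow> ('a, 'b) pre_digraph \<Rightarrow> real" where
  "weight \<epsilon> H = (\<Prod>e\<in>arcs H. \<epsilon> (tail H e) (head H e))"

definition set_weight :: "('a \<Rightarrow> 'a \<Rightarrow> real) \<Rightarrow> ('a, 'b) pre_digraph set \<Rightarrow> real" where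
  "set_weight \<epsilon> S = (\<Sum>H\<in>S. weight \<epsilon> H)"

definition undominated :: "('a, 'b) pre_digraph \<Rightarrow> 'a \<Rightarrow> bool" where
  "undominated G v \<longleftrightarrow> v \<in> verts G \<and> in_degree G v = 0"

definition diverging_forest :: "('a, 'b) pre_digraph \<Rightarrow> bool" where
  "diverging_forest F \<longleftrightarrow> digraph F \<and> forest F \<and> (\<forall>v\<in>verts F. in_degree F v \<le> 1)"

definition roots :: "('a, 'b) pre_digraph \<Rightarrow> 'a set" where
  "roots F = {v. undominated F v}"

text \<open>
  The tree of \<open>F\<close> rooted at \<open>j\<close> is the weak component of the root \<open>j\<close>; weak connectivity
  is reachability in the symmetrised digraph, as in \<^const>\<open>Digraph_Component.connected\<close>.
\<close>

definition in_tree_rooted_at :: "('a, 'b) pre_digraph \<Rightarrow> 'a \<Rightarrow> 'a \<Rightarrow> bool" where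
  "in_tree_rooted_at F j i \<longleftrightarrow> j \<in> roots F \<and> reachable (with_proj (mk_symmetric F)) j i"

definition diverging_tree :: "('a, 'b) pre_digraph \<Rightarrow> bool" where
  "diverging_tree T \<longleftrightarrow> diverging_forest T \<and> Digraph_Component.connected T"

definition spanning_diverging_forests ::
  "('a, 'b) pre_digraph \<Rightarrow> ('a, 'b) pre_digraph set" where
  "spanning_diverging_forests G = {F. spanning F G \<and> diverging_forest F}"

definition maximum_out_forests :: "('a, 'b) pre_digraph \<Rightarrow> ('a, 'b) pre_digraph set" where
  "maximum_out_forests G =
     {F \<in> spanning_diverging_forests G.
        \<forall>F'\<in>spanning_diverging_forests G. card (arcs F') \<le> card (arcs F)}"

text \<open>
  The description below is proper for every \<^locale>\<open>digraph\<close>: see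
  \<open>forest_dimension_eq\<close>.
\<close>

definition forest_dimension :: "('a, 'b) pre_digraph \<Rightarrow> nat" where
  "forest_dimension G = (THE v. \<exists>F\<in>maximum_out_forests G. v = card (roots F))"

definition forests :: "('a, 'b) pre_digraph \<Rightarrow> nat \<Rightarrow> ('a, 'b) pre_digraph set" where
  "forests G k = {F \<in> spanning_diverging_forests G. card (arcs F) = k}"

definition forests_from_to ::
  "('a, 'b) pre_digraph \<Rightarrow> nat \<Rightarrow> 'a \<Rightarrow> 'a \<Rightarrow> ('a, 'b) pre_digraph set" where
  "forests_from_to G k j i = {F \<in> forests G k. in_tree_rooted_at F j i}"

text \<open>Row \<open>i\<close> is the target vertex, column \<open>j\<close> the root.\<close>

definition forest_matrix ::
  "('n::finite \<Rightarrow> 'n \<Rightarrow> real) \<Rightarrow> ('n, 'b) pre_digraph \<Rightarrow> nat \<Rightarrow> real ^ 'n ^ 'n" where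
  "forest_matrix \<epsilon> G k = (\<chi> i j. set_weight \<epsilon> (forests_from_to G k j i))"

definition undominated_knot :: "('a, 'b) pre_digraph \<Rightarrow> 'a set \<Rightarrow> bool" where
  "undominated_knot G K \<longleftrightarrow>
     K \<noteq> {} \<and> K \<subseteq> verts G \<and> (\<forall>u\<in>K. \<forall>w\<in>K. reachable G u w) \<and>
     \<not> (\<exists>e\<in>arcs G. tail G e \<notin> K \<and> head G e \<in> K)"

definition knot_union :: "('a, 'b) pre_digraph \<Rightarrow> 'a set" where
  "knot_union G = \<Union>{K. undominated_knot G K}"

definition reachable_from_set :: "('a, 'b) pre_digraph \<Rightarrow> 'a set \<Rightarrow> 'a \<Rightarrow> bool" where
  "reachable_from_set G K i \<longleftrightarrow> (\<exists>u\<in>K. reachable G u i)"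

definition knot_plus :: "('a, 'b) pre_digraph \<Rightarrow> 'a set \<Rightarrow> 'a set" where
  "knot_plus G K =
     {i \<in> verts G. reachable_from_set G K i \<and>
        (\<forall>K'. undominated_knot G K' \<and> K' \<noteq> K \<longrightarrow> \<not> reachable_from_set G K' i)}"

definition remove_inner_arcs ::
  "('a, 'b) pre_digraph \<Rightarrow> 'a set \<Rightarrow> ('a, 'b) pre_digraph" where
  "remove_inner_arcs G K = G\<lparr>arcs := arcs G - arcs (G \<restriction> K)\<rparr>"

definition knot_trees_from ::
  "('a, 'b) pre_digraph \<Rightarrow> 'a set \<Rightarrow> 'a \<Rightarrow> ('a, 'b) pre_digraph set" where
  "knot_trees_from G K j =
     {T. spanning T (G \<restriction> K) \<and> diverging_tree T \<and> j \<in> roots T}"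

definition outer_forests :: "('a, 'b) pre_digraph \<Rightarrow> 'a set \<Rightarrow> ('a, 'b) pre_digraph set" where
  "outer_forests G K = maximum_out_forests (remove_inner_arcs G K)"

definition outer_forests_to ::
  "('a, 'b) pre_digraph \<Rightarrow> 'a set \<Rightarrow> 'a \<Rightarrow> ('a, 'b) pre_digraph set" where
  "outer_forests_to G K i = {F \<in> outer_forests G K. reachable_from_set F K i}"

lemma card_arcs_plus_card_roots:
  assumes "diverging_forest F"
  shows "card (arcs F) + card (roots F) = card (verts F)"
proof -
  interpret digraph F using assms by (simp add: diverging_forest_def)
  have deg: "in_degree F v = (if v \<in> roots F then 0 else 1)" if "v \<in> verts F" for v
  proof -
    have "in_degree F v \<le> 1" using assms that by (simp add: diverging_forest_def)
    moreover have "v \<in> roots F \<longleftrightarrow> in_degree F v = 0"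
      using that by (simp add: roots_def undominated_def)
    ultimately show ?thesis by simp
  qed
  have sub: "roots F \<subseteq> verts F" by (auto simp only: roots_def undominated_def)
  have fin: "finite (roots F)" using sub finite_verts by (rule finite_subset)
  have UN: "(\<Union>v\<in>verts F. in_arcs F v) = arcs F" by (auto simp: in_arcs_def)
  have "card (\<Union>v\<in>verts F. in_arcs F v) = (\<Sum>v\<in>verts F. card (in_arcs F v))"
  proof (rule card_UN_disjoint[OF finite_verts])
    show "\<forall>v\<in>verts F. finite (in_arcs F v)" using finite_in_arcs by blast
    show "\<forall>v\<in>verts F. \<forall>w\<in>verts F. v \<noteq> w \<longrightarrow> in_arcs F v \<inter> in_arcs F w = {}"
      unfolding in_arcs_def by blast
  qed
  also have "\<dots> = (\<Sum>v\<in>verts F. if v \<in> roots F then 0 else 1)"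
    by (rule sum.cong[OF refl]) (use deg in \<open>simp only: in_degree_def\<close>)
  also have "\<dots> = (\<Sum>v\<in>verts F - roots F. 1)"
    by (rule sum.mono_neutral_cong_right[OF finite_verts]) (simp_all split: if_splits)
  also have "\<dots> = card (verts F) - card (roots F)"
    by (simp only: card_eq_sum[symmetric] card_Diff_subset[OF fin sub])
  finally have "card (arcs F) = card (verts F) - card (roots F)" by (simp only: UN)
  thus ?thesis using card_mono[OF finite_verts sub] by linarith
qed

lemma forest_dimension_eq:
  assumes "F \<in> maximum_out_forests G"
  shows "forest_dimension G = card (roots F)"
proof -
  have mem: "verts F' = verts G" "diverging_forest F'"
    "\<And>F''. F'' \<in> maximum_out_forests G \<Longrightarrow> card (arcs F'') \<le> card (arcs F')"
    if "F' \<in> maximum_out_forests G" for F'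
    using that
    unfolding maximum_out_forests_def spanning_diverging_forests_def spanning_def by blast+
  have "card (roots F') = card (roots F)" if F': "F' \<in> maximum_out_forests G" for F'
    using mem(3)[OF F' assms] mem(3)[OF assms F']
      card_arcs_plus_card_roots[OF mem(2)[OF F']]
      card_arcs_plus_card_roots[OF mem(2)[OF assms]]
    unfolding mem(1)[OF F'] mem(1)[OF assms] by linarith
  thus ?thesis
    unfolding forest_dimension_def using assms by (intro the_equality) blast+
qed

end

theory Submission
  imports Defs
begin

text \<open>
  A spanning forest is encoded by its arc set.  If a root \<open>r\<close> of a maximum out forest were
  outside every undominated knot, some vertex reaching \<open>r\<close> would be unreachable from \<open>r\<close>, and a
  shortest-path forest from the other roots would have more arcs.  The arcs inside an undominated
  knot \<open>K\<close> and the remaining ones can be chosen independently: no arc enters \<open>K\<close>, so a tree on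
  \<open>K\<close> and a forest of \<open>\<Gamma>\<^sub>-\<^sub>K\<close> never close a circuit together.  Hence a spanning forest is maximum
  iff its inner part is a spanning tree of \<open>K\<close> and its outer part is maximum in \<open>\<Gamma>\<^sub>-\<^sub>K\<close>, and
  weights factorize along this bijection.
\<close>

section \<open>Diverging forests\<close>

text \<open>A spanning forest with \<open>k\<close> arcs has \<open>card (verts G) - k\<close>
  roots, so having the most arcs means having the fewest roots, and each extremal step counts
  whichever is handier. All forests that have to be produced (one with a root fewer, a tree of the
  knot, one that reaches a given vertex) come from \<open>exists_forest_with_roots\<close>: once
  every vertex is reachable from \<open>R\<close> through a permitted arc set \<open>B\<close>, some
  forest inside \<open>B\<close> has root set exactly \<open>R\<close>. The indegree bound splits
  between the two parts just as acyclicity does, because an arc is inner precisely when its head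
  lies in \<open>K\<close>. The outer factor does not remember which vertex of \<open>K\<close> is
  the root, since the tree joins that root to all of \<open>K\<close>; this is the source of the
  proportional columns. The row sums and the diagonal sum count every maximum forest once: by the
  root above a fixed vertex, and by its only root in \<open>K\<close>.\<close>

lemma (in wf_digraph) forest_iff_acyclic: "forest G \<longleftrightarrow> acyclic (arcs_ends G)"
proof
  assume F: "forest G"
  show "acyclic (arcs_ends G)"
  proof (rule acyclicI, intro allI notI)
    fix x assume "(x, x) \<in> (arcs_ends G)\<^sup>+"
    then obtain p where "awalk x p x" "p \<noteq> []" by (auto simp: reachable1_awalk)
    hence "closed_w p" by (auto simp: closed_w_def)
    hence "\<exists>p. cycle p" by (rule closed_w_imp_cycle)
    thus False using F by (simp add: forest_def)
  qed
next
  assume A: "acyclic (arcs_ends G)"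
  show "forest G"
    unfolding forest_def
  proof
    assume "\<exists>p. cycle p"
    then obtain p u where "awalk u p u" "p \<noteq> []" by (auto simp: cycle_def)
    hence "(u, u) \<in> (arcs_ends G)\<^sup>+" by (auto simp: reachable1_awalk)
    thus False using A by (simp add: acyclic_def)
  qed
qed

lemma roots_iff:
  assumes "digraph F"
  shows "r \<in> roots F \<longleftrightarrow> r \<in> verts F \<and> (\<nexists>x. (x, r) \<in> arcs_ends F)"
proof -
  interpret digraph F by fact
  have "in_degree F r = 0 \<longleftrightarrow> (\<forall>e\<in>arcs F. head F e \<noteq> r)"
    by (auto simp: in_degree_def card_eq_0_iff[of "in_arcs F r"] finite_in_arcs in_arcs_def)
  thus ?thesis
    by (auto simp: roots_def undominated_def arcs_ends_conv image_iff)
qed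

locale out_forest =
  fixes F :: "('a, 'b) pre_digraph"
  assumes diverging: "diverging_forest F"
begin

sublocale digraph F using diverging by (simp add: diverging_forest_def)

lemma acyclic_arcs: "acyclic (arcs_ends F)"
  using diverging forest_iff_acyclic by (simp add: diverging_forest_def)

lemma wf_arcs: "wf (arcs_ends F)"
  using acyclic_arcs by (simp add: wf_iff_acyclic_if_finite arcs_ends_def)

lemma predecessor_unique:
  assumes "(x, z) \<in> arcs_ends F" "(y, z) \<in> arcs_ends F"
  shows "x = y"
proof -
  obtain d e where d: "d \<in> arcs F" "tail F d = x" "head F d = z"
    and e: "e \<in> arcs F" "tail F e = y" "head F e = z"
    using assms by (metis reachableE)
  have "z \<in> verts F" using d by auto
  hence "card (in_arcs F z) \<le> Suc 0"
    using diverging by (simp add: diverging_forest_def in_degree_def)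
  moreover have "d \<in> in_arcs F z" "e \<in> in_arcs F z" using d e by auto
  ultimately have "d = e"
    using finite_in_arcs[of z] by (simp add: card_le_Suc0_iff_eq)
  thus ?thesis using d e by simp
qed

text \<open>Going back along incoming arcs must stop by well-foundedness, and it can stop only at a
  root.\<close>

lemma exists_root:
  assumes "i \<in> verts F"
  shows "\<exists>j\<in>roots F. (j, i) \<in> (arcs_ends F)\<^sup>*"
  using wf_arcs assms
proof (induction i rule: wf_induct_rule)
  case (less i)
  show ?case
  proof (cases "i \<in> roots F")
    case False
    then obtain x where x: "(x, i) \<in> arcs_ends F"
      using less.prems roots_iff[OF digraph_axioms] by blast
    hence "x \<in> verts F" using adj_in_verts by blast
    then show ?thesis using less.IH[OF x] x by (meson rtrancl.rtrancl_into_rtrancl)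
  qed auto
qed

lemma root_no_pred: "r \<in> roots F \<Longrightarrow> (x, r) \<notin> arcs_ends F"
  by (simp add: roots_iff[OF digraph_axioms])

text \<open>Two paths into the same vertex share their last arc because predecessors are unique.
  Peeling off common arcs continues until one path is empty, and then the other is empty too, as
  nothing precedes a root.\<close>

lemma root_unique:
  assumes "j \<in> roots F" "j' \<in> roots F"
    and "(j, i) \<in> (arcs_ends F)\<^sup>*" "(j', i) \<in> (arcs_ends F)\<^sup>*"
  shows "j = j'"
  using assms(3,4)
proof (induction i rule: rtrancl_induct)
  case base
  then show ?case using root_no_pred[OF assms(1)] by (metis rtranclE)
next
  case (step x y)
  from step.prems show ?case
  proof (cases rule: rtranclE)
    case base
    then show ?thesis using step.hyps root_no_pred[OF assms(2)] by blast
  next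
    case (step z)
    then show ?thesis using predecessor_unique \<open>(x, y) \<in> arcs_ends F\<close> \<open>(j', x) \<in> (arcs_ends F)\<^sup>* \<Longrightarrow> j = j'\<close>
      by blast
  qed
qed

text \<open>The trees of a forest are defined as weak components; from here on directed paths from
  the root can be used instead.\<close>

lemma weakly_reachable_from_root:
  assumes j: "j \<in> roots F"
  shows "reachable (with_proj (mk_symmetric F)) j i \<longleftrightarrow> i \<in> verts F \<and> (j, i) \<in> (arcs_ends F)\<^sup>*"
proof
  assume "reachable (with_proj (mk_symmetric F)) j i"
  hence "(j, i) \<in> rtrancl_on (verts F) (parcs (mk_symmetric F))"
    by (simp add: reachable_def mk_symmetric_def)
  thus "i \<in> verts F \<and> (j, i) \<in> (arcs_ends F)\<^sup>*"
  proof (induction rule: rtrancl_on_induct)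
    case (step x y)
    from \<open>(x, y) \<in> parcs (mk_symmetric F)\<close>
    have "(x, y) \<in> arcs_ends F \<or> (y, x) \<in> arcs_ends F"
      by (auto simp: mk_symmetric_def arcs_ends_conv)
    thus ?case
    proof
      \<comment> \<open>An arc traversed backwards: it is the only arc into \<open>x\<close>, and
        \<open>x\<close> is not the root, so the directed path from \<open>j\<close> to
        \<open>x\<close> already passes through \<open>y\<close>.\<close>
      assume "(y, x) \<in> arcs_ends F"
      moreover have "(j, x) \<in> (arcs_ends F)\<^sup>*" using step by blast
      ultimately have "(j, y) \<in> (arcs_ends F)\<^sup>*"
        using root_no_pred[OF j] predecessor_unique by (metis rtranclE)
      thus ?thesis using step by blast
    qed (use step in \<open>auto intro: rtrancl_into_rtrancl\<close>)
  qed simp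
next
  assume i: "i \<in> verts F \<and> (j, i) \<in> (arcs_ends F)\<^sup>*"
  have "(j, i) \<in> rtrancl_on (verts F) (arcs_ends F)"
    using i j reachable_conv[of j i] roots_iff[OF digraph_axioms] by (simp add: reachable_def)
  hence "(j, i) \<in> rtrancl_on (verts F) (parcs (mk_symmetric F))"
    by (rule rtrancl_on_mono[rotated 2]) (auto simp: mk_symmetric_def arcs_ends_conv)
  thus "reachable (with_proj (mk_symmetric F)) j i"
    by (simp add: reachable_def mk_symmetric_def)
qed

lemma in_tree_rooted_at_iff:
  assumes "i \<in> verts F"
  shows "in_tree_rooted_at F j i \<longleftrightarrow> j \<in> roots F \<and> (j, i) \<in> (arcs_ends F)\<^sup>*"
  using assms weakly_reachable_from_root by (auto simp: in_tree_rooted_at_def)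

text \<open>In a weakly connected forest a second root would be reached from \<open>j\<close> by a
  directed path, against uniqueness of the root. Conversely a single root reaches every vertex, and
  symmetry joins any two vertices through it.\<close>

lemma diverging_tree_iff:
  "diverging_tree F \<and> j \<in> roots F \<longleftrightarrow> roots F = {j}"
proof
  assume L: "diverging_tree F \<and> j \<in> roots F"
  have "r = j" if r: "r \<in> roots F" for r
  proof -
    have "j \<in> verts F" "r \<in> verts F" using L r roots_iff[OF digraph_axioms] by blast+
    hence "reachable (with_proj (mk_symmetric F)) j r"
      using L by (auto simp: diverging_tree_def Digraph_Component.connected_def
          strongly_connected_def mk_symmetric_def)
    thus ?thesis using weakly_reachable_from_root root_unique L r by blast
  qed
  thus "roots F = {j}" using L by blast
next
  assume R: "roots F = {j}"
  have j: "reachable (with_proj (mk_symmetric F)) j i" if "i \<in> verts F" for i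
    using exists_root[OF that] R weakly_reachable_from_root that by simp
  interpret M: wf_digraph "with_proj (mk_symmetric F)"
    by unfold_locales (auto simp: mk_symmetric_def)
  have "symmetric (with_proj (mk_symmetric F))"
    by (auto simp: symmetric_def sym_def mk_symmetric_def)
  hence "reachable (with_proj (mk_symmetric F)) u w" if "u \<in> verts F" "w \<in> verts F" for u w
    using symmetric_reachable[OF _ j[OF that(1)]] j[OF that(2)] M.reachable_trans by blast
  moreover have "verts F \<noteq> {}" using R roots_iff[OF digraph_axioms, of j] by blast
  ultimately have "strongly_connected (with_proj (mk_symmetric F))"
    by (simp add: strongly_connected_def mk_symmetric_def)
  thus "diverging_tree F \<and> j \<in> roots F"
    using R diverging by (simp add: diverging_tree_def Digraph_Component.connected_def)
qed

end

section \<open>Spanning forests as sets of arcs\<close>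

text \<open>Injectivity of \<open>head G\<close> on \<open>A\<close> is the condition that indegrees
  are at most 1.\<close>

definition forest_arcs :: "('a, 'b) pre_digraph \<Rightarrow> 'b set \<Rightarrow> bool" where
  "forest_arcs G A \<longleftrightarrow> A \<subseteq> arcs G \<and> inj_on (head G) A \<and> acyclic (arc_to_ends G ` A)"

definition root_set :: "('a, 'b) pre_digraph \<Rightarrow> 'b set \<Rightarrow> 'a set" where
  "root_set G A = verts G - head G ` A"

definition max_forest_arcs :: "('a, 'b) pre_digraph \<Rightarrow> 'b set \<Rightarrow> bool" where
  "max_forest_arcs G A \<longleftrightarrow>
     forest_arcs G A \<and> (\<forall>A'. forest_arcs G A' \<longrightarrow> card A' \<le> card A)"

definition arcs_weight :: "('a \<Rightarrow> 'a \<Rightarrow> real) \<Rightarrow> ('a, 'b) pre_digraph \<Rightarrow> 'b set \<Rightarrow> real" where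
  "arcs_weight \<epsilon> G A = (\<Prod>e\<in>A. \<epsilon> (tail G e) (head G e))"

lemma arcs_ends_update: "arcs_ends (G\<lparr>arcs := A\<rparr>) = arc_to_ends G ` A"
  by (auto simp: arcs_ends_conv arc_to_ends_def)

lemma set_weight_image:
  "set_weight \<epsilon> ((\<lambda>A. G\<lparr>arcs := A\<rparr>) ` S) = (\<Sum>A\<in>S. arcs_weight \<epsilon> G A)"
proof -
  have "inj_on (\<lambda>A. G\<lparr>arcs := A\<rparr>) S"
    by (rule inj_onI) (metis pre_digraph.select_convs(2) pre_digraph.surjective pre_digraph.update_convs(2))
  thus ?thesis
    by (simp add: set_weight_def weight_def arcs_weight_def sum.reindex)
qed

lemma forest_arcs_mono: "forest_arcs G A \<Longrightarrow> B \<subseteq> A \<Longrightarrow> forest_arcs G B"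
  unfolding forest_arcs_def by (meson acyclic_subset image_mono inj_on_subset subset_trans)

context digraph
begin

lemma digraph_update:
  assumes "A \<subseteq> arcs G"
  shows "digraph (G\<lparr>arcs := A\<rparr>)"
proof -
  have "arc_to_ends (G\<lparr>arcs := A\<rparr>) = arc_to_ends G" by (auto simp: arc_to_ends_def)
  thus ?thesis
    using assms no_loops inj_on_subset[OF inj_on_arc_to_ends assms] finite_subset[OF assms]
    by unfold_locales (auto dest: inj_onD)
qed

lemma diverging_forest_update:
  assumes "A \<subseteq> arcs G"
  shows "diverging_forest (G\<lparr>arcs := A\<rparr>) \<longleftrightarrow> forest_arcs G A"
proof -
  interpret F: digraph "G\<lparr>arcs := A\<rparr>" using assms by (rule digraph_update)
  have "(\<forall>v\<in>verts G. in_degree (G\<lparr>arcs := A\<rparr>) v \<le> 1) \<longleftrightarrow> inj_on (head G) A" (is "?L \<longleftrightarrow> ?R")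
  proof
    assume L: ?L
    show ?R
    proof (rule inj_onI)
      fix d e assume de: "d \<in> A" "e \<in> A" "head G d = head G e"
      hence "in_degree (G\<lparr>arcs := A\<rparr>) (head G e) \<le> 1" using L assms by auto
      thus "d = e"
        using de F.finite_in_arcs[of "head G e"]
        by (simp add: in_degree_def in_arcs_def card_le_Suc0_iff_eq)
    qed
  next
    assume ?R
    thus ?L
      using F.finite_in_arcs
      by (auto simp: in_degree_def in_arcs_def card_le_Suc0_iff_eq dest: inj_onD)
  qed
  thus ?thesis
    using assms F.forest_iff_acyclic F.digraph_axioms
    by (auto simp: diverging_forest_def forest_arcs_def arcs_ends_update)
qed

text \<open>Compatibility forces the same \<open>tail\<close> and \<open>head\<close> maps and
  spanning forces the same vertices, so only the arc set is left to choose. This is what justifies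
  the encoding by arc sets.\<close>

lemma spanning_iff: "spanning H G \<longleftrightarrow> (\<exists>A\<subseteq>arcs G. H = G\<lparr>arcs := A\<rparr>)"
proof
  assume H: "spanning H G"
  hence "arcs H \<subseteq> arcs G" by (simp add: spanning_def subgraph_def)
  moreover have "H = G\<lparr>arcs := arcs H\<rparr>"
    using H by (cases G; cases H) (simp add: spanning_def subgraph_def compatible_def)
  ultimately show "\<exists>A\<subseteq>arcs G. H = G\<lparr>arcs := A\<rparr>" by blast
next
  assume "\<exists>A\<subseteq>arcs G. H = G\<lparr>arcs := A\<rparr>"
  then obtain A where A: "A \<subseteq> arcs G" "H = G\<lparr>arcs := A\<rparr>" by blast
  interpret F: digraph "G\<lparr>arcs := A\<rparr>" using A(1) by (rule digraph_update)
  show "spanning H G"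
    using A wf_digraph F.wf_digraph by (simp add: spanning_def subgraph_def compatible_def)
qed

lemma spanning_diverging_forests_eq:
  "spanning_diverging_forests G = (\<lambda>A. G\<lparr>arcs := A\<rparr>) ` {A. forest_arcs G A}"
  using diverging_forest_update
  by (auto simp: spanning_diverging_forests_def spanning_iff forest_arcs_def)

lemma maximum_out_forests_eq:
  "maximum_out_forests G = (\<lambda>A. G\<lparr>arcs := A\<rparr>) ` {A. max_forest_arcs G A}"
  unfolding maximum_out_forests_def spanning_diverging_forests_eq max_forest_arcs_def by auto

lemma finite_forest_arcs: "finite {A. forest_arcs G A}"
  by (rule finite_subset[of _ "Pow (arcs G)"]) (auto simp: forest_arcs_def)

lemma forest_arcs_finite: "forest_arcs G A \<Longrightarrow> finite A"
  unfolding forest_arcs_def using finite_arcs finite_subset by blast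

lemma out_forest_update: "forest_arcs G A \<Longrightarrow> out_forest (G\<lparr>arcs := A\<rparr>)"
  using diverging_forest_update by (simp add: out_forest_def forest_arcs_def)

lemma roots_update:
  assumes "A \<subseteq> arcs G"
  shows "roots (G\<lparr>arcs := A\<rparr>) = root_set G A"
  using roots_iff[OF digraph_update[OF assms]]
  by (auto simp: root_set_def arcs_ends_update arc_to_ends_def)

lemma card_arcs_plus_card_root_set:
  assumes "forest_arcs G A"
  shows "card A + card (root_set G A) = card (verts G)"
proof -
  have "A \<subseteq> arcs G" using assms by (simp add: forest_arcs_def)
  thus ?thesis
    using card_arcs_plus_card_roots[of "G\<lparr>arcs := A\<rparr>"] assms
    by (simp add: diverging_forest_update roots_update)
qed

lemma exists_root_arcs:
  assumes "forest_arcs G A" "i \<in> verts G"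
  shows "\<exists>j\<in>root_set G A. (j, i) \<in> (arc_to_ends G ` A)\<^sup>*"
  using out_forest.exists_root[OF out_forest_update[OF assms(1)]] assms
  by (simp add: arcs_ends_update roots_update forest_arcs_def)

lemma root_unique_arcs:
  assumes "forest_arcs G A" "j \<in> root_set G A" "j' \<in> root_set G A"
    and "(j, i) \<in> (arc_to_ends G ` A)\<^sup>*" "(j', i) \<in> (arc_to_ends G ` A)\<^sup>*"
  shows "j = j'"
  using out_forest.root_unique[OF out_forest_update[OF assms(1)], of j j' i] assms
  by (simp add: arcs_ends_update roots_update forest_arcs_def)

lemma in_tree_update:
  assumes "forest_arcs G A" "i \<in> verts G"
  shows "in_tree_rooted_at (G\<lparr>arcs := A\<rparr>) j i \<longleftrightarrow>
    j \<in> root_set G A \<and> (j, i) \<in> (arc_to_ends G ` A)\<^sup>*"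
  using out_forest.in_tree_rooted_at_iff[OF out_forest_update[OF assms(1)], of i j] assms
  by (simp add: arcs_ends_update roots_update forest_arcs_def)

lemma exists_max_forest_arcs: "\<exists>A. max_forest_arcs G A"
proof -
  let ?S = "{A. forest_arcs G A}"
  have "{} \<in> ?S" by (simp add: forest_arcs_def acyclic_def)
  hence "?S \<noteq> {}" by blast
  hence "Max (card ` ?S) \<in> card ` ?S"
    using finite_forest_arcs by (intro Max_in) auto
  then obtain A where A: "A \<in> ?S" "card A = Max (card ` ?S)" by auto
  have "card B \<le> card A" if "B \<in> ?S" for B
    unfolding A(2) using finite_forest_arcs that by (intro Max_ge) auto
  thus ?thesis using A(1) unfolding max_forest_arcs_def by blast
qed

text \<open>The forest dimension is the root count of any maximum forest \<open>M\<close>, so the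
  difference is exactly \<open>card M\<close>, with no truncation in the subtraction; a forest with
  that many arcs is itself maximum.\<close>

lemma forests_eq_maximum_out_forests:
  "forests G (card (verts G) - forest_dimension G) = maximum_out_forests G"
proof -
  obtain M where M: "max_forest_arcs G M" using exists_max_forest_arcs by blast
  hence sub: "M \<subseteq> arcs G" and F: "forest_arcs G M"
    by (simp_all add: max_forest_arcs_def forest_arcs_def)
  have "G\<lparr>arcs := M\<rparr> \<in> maximum_out_forests G"
    using M by (simp add: maximum_out_forests_eq)
  hence "forest_dimension G = card (root_set G M)"
    using forest_dimension_eq[of "G\<lparr>arcs := M\<rparr>" G] roots_update[OF sub] by simp
  hence k: "card (verts G) - forest_dimension G = card M"
    using card_arcs_plus_card_root_set[OF F] by linarith
  have "forest_arcs G A \<and> card A = card M \<longleftrightarrow> max_forest_arcs G A" for A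
    using M unfolding max_forest_arcs_def by (auto intro: order.antisym)
  hence "{A. max_forest_arcs G A} = {A. forest_arcs G A \<and> card A = card M}" by blast
  moreover have "forests G (card M) =
      (\<lambda>A. G\<lparr>arcs := A\<rparr>) ` {A. forest_arcs G A \<and> card A = card M}"
    unfolding forests_def spanning_diverging_forests_eq by auto
  ultimately show ?thesis
    unfolding maximum_out_forests_eq k by simp
qed

text \<open>Every vertex outside \<open>R\<close> selects an arc of \<open>B\<close> coming from a vertex closer to \<open>R\<close>.\<close>

lemma exists_forest_with_roots:
  assumes "B \<subseteq> arcs G" "R \<subseteq> verts G"
    and reach: "\<And>i. i \<in> verts G \<Longrightarrow> \<exists>r\<in>R. (r, i) \<in> (arc_to_ends G ` B)\<^sup>*"
  shows "\<exists>A\<subseteq>B. forest_arcs G A \<and> root_set G A = R"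
proof -
  let ?E = "arc_to_ends G ` B"
  let ?P = "\<lambda>i m. \<exists>r\<in>R. (r, i) \<in> ?E ^^ m"
  \<comment> \<open>The distance of \<open>i\<close> from \<open>R\<close> along arcs of
    \<open>B\<close>.\<close>
  define d where "d i = (LEAST m. ?P i m)" for i
  have P: "?P i (d i)" if i: "i \<in> verts G" for i
  proof -
    obtain r where "r \<in> R" "(r, i) \<in> ?E\<^sup>*" using reach[OF i] by blast
    then obtain m where "(r, i) \<in> ?E ^^ m" using rtrancl_imp_relpow by blast
    hence "?P i m" using \<open>r \<in> R\<close> by blast
    thus ?thesis unfolding d_def by (rule LeastI)
  qed
  have "\<exists>e\<in>B. head G e = i \<and> d (tail G e) < d i" if i: "i \<in> verts G - R" for i
  proof -
    obtain r where r: "r \<in> R" "(r, i) \<in> ?E ^^ d i" using P i by blast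
    moreover have "d i \<noteq> 0"
    proof
      assume "d i = 0"
      hence "r = i" using r(2) by simp
      thus False using i r(1) by blast
    qed
    then obtain m where m: "d i = Suc m" by (cases "d i") auto
    ultimately obtain x where x: "(r, x) \<in> ?E ^^ m" "(x, i) \<in> ?E" by auto
    \<comment> \<open>The last arc of a shortest path starts at a strictly smaller distance.\<close>
    have "d x \<le> m" unfolding d_def by (rule Least_le) (use r x in blast)
    thus ?thesis using x(2) m by (auto simp: arc_to_ends_def)
  qed
  hence "\<forall>i\<in>verts G - R. \<exists>e. e \<in> B \<and> head G e = i \<and> d (tail G e) < d i" by blast
  from bchoice[OF this] obtain p
    where p: "\<And>i. i \<in> verts G - R \<Longrightarrow> p i \<in> B \<and> head G (p i) = i \<and> d (tail G (p i)) < d i"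
    by blast
  define A where "A = p ` (verts G - R)"
  have AB: "A \<subseteq> B" using p by (auto simp: A_def)
  have head_A: "head G ` A = verts G - R"
    unfolding A_def image_image using image_cong[OF refl, of "verts G - R" "\<lambda>i. head G (p i)" id] p
    by simp
  have "inj_on (head G) A" using p by (auto simp: A_def inj_on_def)
  \<comment> \<open>Distance strictly increases along every selected arc.\<close>
  moreover have "acyclic (arc_to_ends G ` A)"
  proof (rule acyclic_subset)
    show "arc_to_ends G ` A \<subseteq> measure d" using p by (auto simp: A_def arc_to_ends_def)
    show "acyclic (measure d)" by (simp add: wf_acyclic)
  qed
  moreover have "root_set G A = R" using head_A assms(2) by (auto simp: root_set_def)
  ultimately show ?thesis using AB assms(1) unfolding forest_arcs_def by blast
qed

lemma arcs_ends_image: "arc_to_ends G ` arcs G = arcs_ends G"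
  by (simp add: arcs_ends_def)

lemma arc_rel_mono: "A \<subseteq> arcs G \<Longrightarrow> (u, w) \<in> (arc_to_ends G ` A)\<^sup>* \<Longrightarrow> (u, w) \<in> (arcs_ends G)\<^sup>*"
  unfolding arcs_ends_def by (rule subsetD[OF rtrancl_mono[OF image_mono]])

lemma exists_root_reaching:
  assumes "forest_arcs G A" "i \<in> verts G"
  shows "\<exists>j\<in>root_set G A. (j, i) \<in> (arcs_ends G)\<^sup>*"
proof -
  obtain j where j: "j \<in> root_set G A" "(j, i) \<in> (arc_to_ends G ` A)\<^sup>*"
    using exists_root_arcs[OF assms] by (rule bexE)
  have "A \<subseteq> arcs G" using assms(1) by (simp add: forest_arcs_def)
  thus ?thesis using arc_rel_mono[of A j i] j by (intro bexI)
qed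

lemma card_root_set_le:
  assumes "max_forest_arcs G A" "forest_arcs G A'"
  shows "card (root_set G A) \<le> card (root_set G A')"
proof -
  have "card A' \<le> card A" "forest_arcs G A" using assms by (auto simp: max_forest_arcs_def)
  thus ?thesis
    using card_arcs_plus_card_root_set[OF assms(2)] card_arcs_plus_card_root_set[of A] by linarith
qed

section \<open>Undominated knots\<close>

lemma knot_pred_closed:
  assumes K: "undominated_knot G K" and "(u, w) \<in> (arcs_ends G)\<^sup>*" "w \<in> K"
  shows "u \<in> K"
  using assms(2,3)
proof (induction rule: converse_rtrancl_induct)
  case (step x y)
  then show ?case using K by (auto simp: undominated_knot_def arcs_ends_conv)
qed simp

lemma knot_mutual:
  assumes "undominated_knot G K" "u \<in> K" "w \<in> K"
  shows "(u, w) \<in> (arcs_ends G)\<^sup>*"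
  using assms unfolding undominated_knot_def by (meson reachable_rtranclI)

text \<open>Since no arc enters \<open>L\<close>, a path from \<open>u\<close> into \<open>L\<close>
  starts in \<open>L\<close>; mutual reachability within each knot then pulls all of it into the
  other. So distinct knots are disjoint and never reach each other.\<close>

lemma knots_eq:
  assumes K: "undominated_knot G K" and L: "undominated_knot G L"
    and "u \<in> K" "w \<in> L" "(u, w) \<in> (arcs_ends G)\<^sup>*"
  shows "K = L"
proof -
  have u: "u \<in> L" using knot_pred_closed[OF L] assms by blast
  have "x \<in> L" if "x \<in> K" for x
    using knot_pred_closed[OF L knot_mutual[OF K that \<open>u \<in> K\<close>] u] .
  moreover have "x \<in> K" if "x \<in> L" for x
    using knot_pred_closed[OF K knot_mutual[OF L that u] \<open>u \<in> K\<close>] .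
  ultimately show ?thesis by blast
qed

lemma undominated_singleton_knot:
  assumes "undominated G j"
  shows "undominated_knot G {j}"
proof -
  have "j \<in> roots G" using assms by (simp add: roots_def)
  hence "j \<in> verts G" "\<nexists>x. (x, j) \<in> arcs_ends G"
    using roots_iff[OF digraph_axioms] by blast+
  thus ?thesis by (auto simp: undominated_knot_def arcs_ends_conv image_iff)
qed

text \<open>
  If the predecessors of a root \<open>r\<close> do not form a knot, then some \<open>u\<close> reaching \<open>r\<close> is not
  reachable from \<open>r\<close>; the remaining roots then reach every vertex, so \<open>r\<close> can be spared.
\<close>

lemma max_forest_root_in_knot:
  assumes A: "max_forest_arcs G A" and r: "r \<in> root_set G A"
  shows "r \<in> knot_union G"
proof (rule ccontr)
  assume not: "r \<notin> knot_union G"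
  have FA: "forest_arcs G A" using A by (simp add: max_forest_arcs_def)
  have rV: "r \<in> verts G" using r by (simp add: root_set_def)
  let ?C = "{x \<in> verts G. (x, r) \<in> (arcs_ends G)\<^sup>*}"
  \<comment> \<open>The set \<open>?C\<close> is closed under predecessors by construction, so only
    mutual reachability can fail; otherwise \<open>?C\<close> would be a knot containing
    \<open>r\<close>.\<close>
  have "\<exists>u\<in>?C. (r, u) \<notin> (arcs_ends G)\<^sup>*"
  proof (rule ccontr)
    assume "\<not> ?thesis"
    hence all: "\<And>u. u \<in> ?C \<Longrightarrow> (r, u) \<in> (arcs_ends G)\<^sup>*" by blast
    have "reachable G u w" if "u \<in> ?C" "w \<in> ?C" for u w
      using that all[OF that(2)] by (auto simp: reachable_conv)
    moreover have "tail G e \<in> ?C" if "e \<in> arcs G" "head G e \<in> ?C" for e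
      using that by (auto intro: converse_rtrancl_into_rtrancl simp: arcs_ends_conv)
    ultimately have "undominated_knot G ?C" using rV by (auto simp: undominated_knot_def)
    thus False using not rV unfolding knot_union_def by blast
  qed
  then obtain u where u: "u \<in> verts G" "(u, r) \<in> (arcs_ends G)\<^sup>*" "(r, u) \<notin> (arcs_ends G)\<^sup>*"
    by blast
  let ?R = "root_set G A - {r}"
  have "\<exists>s\<in>?R. (s, i) \<in> (arc_to_ends G ` arcs G)\<^sup>*" if i: "i \<in> verts G" for i
  proof -
    obtain s where s: "s \<in> root_set G A" "(s, i) \<in> (arcs_ends G)\<^sup>*"
      using exists_root_reaching[OF FA i] by (rule bexE)
    \<comment> \<open>The root above \<open>u\<close> cannot be \<open>r\<close>, which does not
      reach \<open>u\<close>. Through \<open>u\<close> it reaches \<open>r\<close>, so it takes over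
      every vertex that was served by \<open>r\<close>.\<close>
    obtain t where t: "t \<in> root_set G A" "(t, u) \<in> (arcs_ends G)\<^sup>*"
      using exists_root_reaching[OF FA u(1)] by (rule bexE)
    have "t \<noteq> r" using t u by blast
    thus ?thesis
      using s t u(2) unfolding arcs_ends_image by (cases "s = r") (auto intro: rtrancl_trans)
  qed
  then obtain A' where A': "forest_arcs G A'" "root_set G A' = ?R"
    using exists_forest_with_roots[OF order_refl, of ?R] by (auto simp: root_set_def)
  have "finite (root_set G A)" by (simp add: root_set_def)
  hence "card ?R < card (root_set G A)" using r by (intro psubset_card_mono) auto
  thus False using card_root_set_le[OF A A'(1)] A'(2) by simp
qed

end

section \<open>Splitting maximum forests along a fixed undominated knot\<close>

locale knot_digraph = digraph G for G :: "('a, 'b) pre_digraph" +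
  fixes K :: "'a set"
  assumes knot: "undominated_knot G K"
begin

abbreviation inner :: "'b set" where
  "inner \<equiv> arcs (G \<restriction> K)"

text \<open>The root set is taken in the restriction to \<open>K\<close>: in \<open>G\<close> all
  vertices outside \<open>K\<close> would be roots of \<open>T\<close> as well.\<close>

definition tree_arcs :: "'a \<Rightarrow> 'b set set" where
  "tree_arcs j = {T. T \<subseteq> inner \<and> forest_arcs G T \<and> root_set (G \<restriction> K) T = {j}}"

lemma knot_subset: "K \<subseteq> verts G"
  using knot by (simp add: undominated_knot_def)

lemma finite_knot: "finite K"
  using knot_subset finite_verts finite_subset by blast

text \<open>No arc enters \<open>K\<close> from outside, so a head in \<open>K\<close> forces the
  tail into \<open>K\<close>. Membership in the inner part thus depends on the head alone, as do the
  roots of a forest.\<close>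

lemma inner_eq: "inner = {e \<in> arcs G. head G e \<in> K}"
  using knot by (auto simp: undominated_knot_def)

lemma arc_to_ends_restrict: "arc_to_ends (G \<restriction> K) = arc_to_ends G"
  by (auto simp: arc_to_ends_def)

lemma digraph_restrict: "digraph (G \<restriction> K)"
  using digraphI_induced[OF induced_induce[OF knot_subset]] .

lemma digraph_remove: "digraph (remove_inner_arcs G K)"
  unfolding remove_inner_arcs_def by (rule digraph_update) blast

lemma forest_arcs_restrict: "forest_arcs (G \<restriction> K) T \<longleftrightarrow> T \<subseteq> inner \<and> forest_arcs G T"
  by (auto simp: forest_arcs_def arc_to_ends_restrict)

lemma arc_to_ends_remove: "arc_to_ends (remove_inner_arcs G K) = arc_to_ends G"
  by (auto simp: arc_to_ends_def remove_inner_arcs_def)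

lemma forest_arcs_remove:
  "forest_arcs (remove_inner_arcs G K) B \<longleftrightarrow> B \<subseteq> arcs G - inner \<and> forest_arcs G B"
  unfolding forest_arcs_def arc_to_ends_remove by (auto simp: remove_inner_arcs_def)

lemma root_set_restrict: "root_set (G \<restriction> K) T = K - head G ` T"
  by (simp add: root_set_def)

lemma card_inner_forest:
  assumes "forest_arcs G T" "T \<subseteq> inner"
  shows "card T + card (root_set (G \<restriction> K) T) = card K" "root_set (G \<restriction> K) T \<noteq> {}"
proof -
  interpret R: digraph "G \<restriction> K" by (rule digraph_restrict)
  have T: "forest_arcs (G \<restriction> K) T" using assms by (simp add: forest_arcs_restrict)
  show "card T + card (root_set (G \<restriction> K) T) = card K"
    using R.card_arcs_plus_card_root_set[OF T] by simp
  obtain i where "i \<in> K" using knot by (auto simp: undominated_knot_def)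
  thus "root_set (G \<restriction> K) T \<noteq> {}" using R.exists_root_arcs[OF T, of i] by auto
qed

lemma card_inner_forest_less:
  assumes "forest_arcs G T" "T \<subseteq> inner"
  shows "Suc (card T) \<le> card K"
proof -
  have "finite (root_set (G \<restriction> K) T)" using finite_knot by (simp add: root_set_restrict)
  hence "card (root_set (G \<restriction> K) T) > 0"
    using card_inner_forest(2)[OF assms] by (simp add: card_gt_0_iff)
  thus ?thesis using card_inner_forest(1)[OF assms] by linarith
qed

text \<open>A tree is an inner forest with one root left, that is, with one arc fewer than
  \<open>K\<close> has vertices; \<open>Suc\<close> avoids the subtraction.\<close>

lemma tree_arcs_iff_card:
  assumes "forest_arcs G T" "T \<subseteq> inner"
  shows "(\<exists>j\<in>K. T \<in> tree_arcs j) \<longleftrightarrow> Suc (card T) = card K"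
proof -
  have "Suc (card T) = card K \<longleftrightarrow> card (root_set (G \<restriction> K) T) = 1"
    using card_inner_forest(1)[OF assms] by linarith
  also have "\<dots> \<longleftrightarrow> (\<exists>j. root_set (G \<restriction> K) T = {j})"
    by (rule card_1_singleton_iff[unfolded One_nat_def[symmetric]])
  also have "\<dots> \<longleftrightarrow> (\<exists>j\<in>K. root_set (G \<restriction> K) T = {j})"
    unfolding root_set_restrict by blast
  finally show ?thesis using assms by (simp add: tree_arcs_def)
qed

text \<open>A path that ends in \<open>K\<close> has never been outside \<open>K\<close>, so mutual
  reachability in \<open>G\<close> is already realized by inner arcs, and
  \<open>exists_forest_with_roots\<close> applies to the restriction with
  \<open>R = {j}\<close>.\<close>

lemma exists_tree:
  assumes j: "j \<in> K"
  shows "\<exists>T. T \<in> tree_arcs j"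
proof -
  interpret R: digraph "G \<restriction> K" by (rule digraph_restrict)
  have inner_path: "(u, w) \<in> (arc_to_ends G ` inner)\<^sup>*"
    if "(u, w) \<in> (arcs_ends G)\<^sup>*" "w \<in> K" for u w
    using that
  proof (induction rule: converse_rtrancl_induct)
    case (step x y)
    have "y \<in> K" using knot_pred_closed[OF knot step.hyps(2) step.prems] .
    hence "(x, y) \<in> arc_to_ends G ` inner"
      using step.hyps(1) unfolding inner_eq by (auto simp: arcs_ends_def arc_to_ends_def)
    thus ?case using step by (meson converse_rtrancl_into_rtrancl)
  qed simp
  have "\<exists>A\<subseteq>inner. forest_arcs (G \<restriction> K) A \<and> root_set (G \<restriction> K) A = {j}"
  proof (rule R.exists_forest_with_roots)
    fix i assume "i \<in> verts (G \<restriction> K)"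
    thus "\<exists>r\<in>{j}. (r, i) \<in> (arc_to_ends (G \<restriction> K) ` inner)\<^sup>*"
      using inner_path knot_mutual[OF knot j] unfolding arc_to_ends_restrict by auto
  qed (use j in auto)
  thus ?thesis unfolding tree_arcs_def forest_arcs_restrict by blast
qed

lemma exists_knot_tree: "\<exists>j\<in>K. \<exists>T. T \<in> tree_arcs j"
proof -
  obtain j where "j \<in> K" using knot by (auto simp: undominated_knot_def)
  thus ?thesis using exists_tree by blast
qed

text \<open>Heads of \<open>T\<close> lie in \<open>K\<close> and heads of \<open>B\<close> outside,
  which preserves injectivity. Tails of \<open>T\<close> lie in \<open>K\<close> too, so no arc of
  \<open>T\<close> can follow an arc of \<open>B\<close>, and a circuit would have to stay in one
  part.\<close>

lemma forest_arcs_Un: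
  assumes T: "forest_arcs G T" "T \<subseteq> inner" and B: "forest_arcs G B" "B \<subseteq> arcs G - inner"
  shows "forest_arcs G (T \<union> B)"
proof -
  let ?E = "\<lambda>A. arc_to_ends G ` A"
  have headT: "head G ` T \<subseteq> K" using T(2) unfolding inner_eq by blast
  have headB: "head G ` B \<inter> K = {}" using B(2) unfolding inner_eq by blast
  have tailT: "tail G ` T \<subseteq> K" using T(2) by auto
  have wf: "wf (?E T)" "wf (?E B)"
    using T(1) B(1) forest_arcs_finite
    by (auto simp: forest_arcs_def intro!: finite_acyclic_wf)
  have "Domain (?E T) \<inter> Range (?E B) = {}"
    using tailT headB by (auto simp: arc_to_ends_def)
  hence "wf (?E T \<union> ?E B)" by (rule wf_Un[OF wf])
  hence "acyclic (?E (T \<union> B))" unfolding image_Un by (rule wf_acyclic)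
  moreover have "inj_on (head G) (T \<union> B)"
    using T(1) B(1) headT headB unfolding inj_on_Un forest_arcs_def by blast
  moreover have "T \<union> B \<subseteq> arcs G" using T(1) B(1) by (auto simp: forest_arcs_def)
  ultimately show ?thesis by (simp add: forest_arcs_def)
qed

lemma card_split:
  assumes "forest_arcs G A"
  shows "card A = card (A \<inter> inner) + card (A - inner)"
  using forest_arcs_finite[OF assms] by (metis Int_Diff_disjoint Int_Diff_Un card_Un_disjoint finite_Diff finite_Int)

text \<open>The arc count is the sum of the inner and the outer count, and gluing realizes every
  pair of parts, so each summand has to be maximal on its own; the inner maximum is attained exactly
  by the trees.\<close>

lemma max_forest_arcs_iff:
  "max_forest_arcs G A \<longleftrightarrow> A \<subseteq> arcs G \<and> (\<exists>j\<in>K. A \<inter> inner \<in> tree_arcs j) \<and>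
     max_forest_arcs (remove_inner_arcs G K) (A - inner)" (is "_ \<longleftrightarrow> ?R")
proof
  assume A: "max_forest_arcs G A"
  hence FA: "forest_arcs G A" by (simp add: max_forest_arcs_def)
  have sub: "A \<subseteq> arcs G" using FA by (simp add: forest_arcs_def)
  have F1: "forest_arcs G (A \<inter> inner)" and F2: "forest_arcs G (A - inner)"
    by (simp_all add: forest_arcs_mono[OF FA])
  obtain j T where T: "j \<in> K" "T \<in> tree_arcs j" using exists_knot_tree by blast
  hence FT: "forest_arcs G T" "T \<subseteq> inner" by (simp_all add: tree_arcs_def)
  have cT: "Suc (card T) = card K" using tree_arcs_iff_card[OF FT] T by blast
  have le: "Suc (card (A \<inter> inner)) \<le> card K" using card_inner_forest_less[OF F1] by simp
  \<comment> \<open>Gluing \<open>B\<close> to a fixed tree. With \<open>B = A - inner\<close> this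
    forces the inner part of \<open>A\<close> to be a tree; with arbitrary \<open>B\<close> it makes
    the outer part maximal.\<close>
  have bound: "Suc (card A) \<ge> card K + card B"
    if B: "forest_arcs (remove_inner_arcs G K) B" for B
  proof -
    have B': "forest_arcs G B" "B \<subseteq> arcs G - inner" using B by (simp_all add: forest_arcs_remove)
    have "card (T \<union> B) \<le> card A"
      using A forest_arcs_Un[OF FT B'] by (simp add: max_forest_arcs_def)
    moreover have "card (T \<union> B) = card T + card B"
      using FT(2) B'(2) forest_arcs_finite[OF FT(1)] forest_arcs_finite[OF B'(1)]
      by (intro card_Un_disjoint) auto
    ultimately show ?thesis using cT by linarith
  qed
  have F2': "forest_arcs (remove_inner_arcs G K) (A - inner)"
    using F2 sub by (auto simp: forest_arcs_remove)
  have "Suc (card (A \<inter> inner)) = card K"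
    using bound[OF F2'] le card_split[OF FA] by linarith
  hence "\<exists>j\<in>K. A \<inter> inner \<in> tree_arcs j" using tree_arcs_iff_card[OF F1] by simp
  moreover have "max_forest_arcs (remove_inner_arcs G K) (A - inner)"
    unfolding max_forest_arcs_def
  proof (intro conjI F2' allI impI)
    fix B assume "forest_arcs (remove_inner_arcs G K) B"
    thus "card B \<le> card (A - inner)" using bound[of B] le card_split[OF FA] by linarith
  qed
  ultimately show ?R using sub by blast
next
  assume R: ?R
  then obtain j where j: "j \<in> K" "A \<inter> inner \<in> tree_arcs j" by blast
  have M: "max_forest_arcs (remove_inner_arcs G K) (A - inner)" using R by blast
  have F1: "forest_arcs G (A \<inter> inner)" "A \<inter> inner \<subseteq> inner"
    using j by (simp_all add: tree_arcs_def)
  have F2: "forest_arcs G (A - inner)" "A - inner \<subseteq> arcs G - inner"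
    using M by (simp_all add: max_forest_arcs_def forest_arcs_remove)
  have FA: "forest_arcs G A" using forest_arcs_Un[OF F1 F2] by (simp add: Int_Diff_Un)
  have c: "Suc (card (A \<inter> inner)) = card K" using tree_arcs_iff_card[OF F1] j by blast
  show "max_forest_arcs G A"
    unfolding max_forest_arcs_def
  proof (intro conjI FA allI impI)
    fix A' assume A': "forest_arcs G A'"
    have "A' \<subseteq> arcs G" using A' by (simp add: forest_arcs_def)
    hence "forest_arcs (remove_inner_arcs G K) (A' - inner)"
      using forest_arcs_mono[OF A', of "A' - inner"] by (auto simp: forest_arcs_remove)
    hence "card (A' - inner) \<le> card (A - inner)" using M unfolding max_forest_arcs_def by blast
    moreover have "Suc (card (A' \<inter> inner)) \<le> card K"
      using card_inner_forest_less[OF forest_arcs_mono[OF A']] by simp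
    ultimately show "card A' \<le> card A"
      using card_split[OF FA] card_split[OF A'] c by linarith
  qed
qed

lemma root_set_Int_knot:
  assumes "A \<subseteq> arcs G"
  shows "root_set G A \<inter> K = root_set (G \<restriction> K) (A \<inter> inner)"
  using assms knot_subset unfolding inner_eq root_set_restrict by (auto simp: root_set_def)

lemma max_forest_root_in_K:
  assumes "max_forest_arcs G A"
  shows "\<exists>j\<in>K. root_set G A \<inter> K = {j}"
proof -
  have sub: "A \<subseteq> arcs G" and "\<exists>j\<in>K. A \<inter> inner \<in> tree_arcs j"
    using assms by (simp_all add: max_forest_arcs_iff)
  thus ?thesis unfolding root_set_Int_knot[OF sub] by (auto simp: tree_arcs_def)
qed

lemma max_forest_arcs_root_iff:
  assumes "j \<in> K"
  shows "max_forest_arcs G A \<and> j \<in> root_set G A \<longleftrightarrow> A \<subseteq> arcs G \<and> A \<inter> inner \<in> tree_arcs j \<and>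
     max_forest_arcs (remove_inner_arcs G K) (A - inner)" (is "?L \<longleftrightarrow> ?R")
proof
  assume ?L
  then obtain k where k: "A \<subseteq> arcs G" "A \<inter> inner \<in> tree_arcs k"
     "max_forest_arcs (remove_inner_arcs G K) (A - inner)"
    by (auto simp: max_forest_arcs_iff)
  have "root_set G A \<inter> K = {k}"
    using k(2) unfolding root_set_Int_knot[OF k(1)] by (simp add: tree_arcs_def)
  moreover have "j \<in> root_set G A \<inter> K" using \<open>?L\<close> assms by blast
  ultimately have "k = j" by simp
  thus ?R using k by blast
next
  assume R: ?R
  hence "root_set G A \<inter> K = {j}"
    using root_set_Int_knot[of A] by (simp add: tree_arcs_def)
  hence "j \<in> root_set G A" by blast
  moreover have "max_forest_arcs G A" unfolding max_forest_arcs_iff using R assms by blast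
  ultimately show ?L by blast
qed

text \<open>An arc of \<open>T\<close> ends in \<open>K\<close>, so a mixed path can be restarted
  after its last arc of \<open>T\<close>; conversely the tree leads from \<open>j\<close> to any
  starting point in \<open>K\<close>. The right-hand side mentions neither \<open>j\<close> nor
  \<open>T\<close>, which is what lets the path condition go entirely into the outer factor.\<close>

lemma reachable_Un_iff:
  assumes j: "j \<in> K" and T: "T \<in> tree_arcs j" and B: "B \<subseteq> arcs G - inner"
  shows "(j, i) \<in> (arc_to_ends G ` (T \<union> B))\<^sup>* \<longleftrightarrow> (\<exists>k\<in>K. (k, i) \<in> (arc_to_ends G ` B)\<^sup>*)"
proof
  assume "(j, i) \<in> (arc_to_ends G ` (T \<union> B))\<^sup>*"
  thus "\<exists>k\<in>K. (k, i) \<in> (arc_to_ends G ` B)\<^sup>*"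
  proof (induction rule: rtrancl_induct)
    case base
    then show ?case using j by blast
  next
    case (step x y)
    from step.hyps(2) consider "(x, y) \<in> arc_to_ends G ` T" | "(x, y) \<in> arc_to_ends G ` B" by blast
    then show ?case
    proof cases
      case 1
      hence "y \<in> K" using T by (auto simp: tree_arcs_def arc_to_ends_def)
      then show ?thesis by blast
    next
      case 2
      then show ?thesis using step.IH by (meson rtrancl_into_rtrancl)
    qed
  qed
next
  interpret R: digraph "G \<restriction> K" by (rule digraph_restrict)
  assume "\<exists>k\<in>K. (k, i) \<in> (arc_to_ends G ` B)\<^sup>*"
  then obtain k where k: "k \<in> K" "(k, i) \<in> (arc_to_ends G ` B)\<^sup>*" by blast
  have FT: "forest_arcs (G \<restriction> K) T" "root_set (G \<restriction> K) T = {j}"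
    using T unfolding tree_arcs_def forest_arcs_restrict by blast+
  hence "(j, k) \<in> (arc_to_ends G ` T)\<^sup>*"
    using R.exists_root_arcs[OF FT(1), of k] k(1) by (simp add: arc_to_ends_restrict)
  moreover have "(arc_to_ends G ` T)\<^sup>* \<subseteq> (arc_to_ends G ` (T \<union> B))\<^sup>*"
    "(arc_to_ends G ` B)\<^sup>* \<subseteq> (arc_to_ends G ` (T \<union> B))\<^sup>*"
    by (rule rtrancl_mono, blast)+
  ultimately show "(j, i) \<in> (arc_to_ends G ` (T \<union> B))\<^sup>*"
    using k(2) by (meson rtrancl_trans subsetD)
qed

text \<open>The factorization at the level of arc sets: \<open>max_forest_arcs_root_iff\<close> and
  \<open>reachable_Un_iff\<close> turn the condition on \<open>A\<close> into independent conditions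
  on its two parts, and weights multiply over the disjoint union.\<close>

lemma sum_max_forest_arcs:
  assumes j: "j \<in> K"
  shows "(\<Sum>A | max_forest_arcs G A \<and> j \<in> root_set G A \<and> (j, i) \<in> (arc_to_ends G ` A)\<^sup>*. arcs_weight \<epsilon> G A)
    = (\<Sum>T\<in>tree_arcs j. arcs_weight \<epsilon> G T) *
      (\<Sum>B | max_forest_arcs (remove_inner_arcs G K) B \<and> (\<exists>k\<in>K. (k, i) \<in> (arc_to_ends G ` B)\<^sup>*).
        arcs_weight \<epsilon> G B)"
    (is "sum _ ?S = _ * sum _ ?P")
proof -
  have TD: "T \<subseteq> inner" "finite T" if "T \<in> tree_arcs j" for T
    using that forest_arcs_finite by (auto simp: tree_arcs_def)
  have BD: "B \<subseteq> arcs G - inner" "finite B" if "B \<in> ?P" for B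
    using that forest_arcs_finite by (auto simp: max_forest_arcs_def forest_arcs_remove)
  have "(\<Sum>T\<in>tree_arcs j. arcs_weight \<epsilon> G T) * (\<Sum>B\<in>?P. arcs_weight \<epsilon> G B)
      = (\<Sum>(T, B)\<in>tree_arcs j \<times> ?P. arcs_weight \<epsilon> G T * arcs_weight \<epsilon> G B)"
    by (simp add: sum_product sum.cartesian_product)
  also have "\<dots> = sum (arcs_weight \<epsilon> G) ?S"
  proof (rule sum.reindex_bij_witness[where j = "\<lambda>(T, B). T \<union> B" and i = "\<lambda>A. (A \<inter> inner, A - inner)"])
    fix x assume x: "x \<in> tree_arcs j \<times> ?P"
    obtain T B where TB: "x = (T, B)" "T \<in> tree_arcs j" "B \<in> ?P" using x by blast
    have split: "(T \<union> B) \<inter> inner = T" "(T \<union> B) - inner = B"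
      using TD(1)[OF TB(2)] BD(1)[OF TB(3)] by blast+
    have sub: "T \<union> B \<subseteq> arcs G" using TD(1)[OF TB(2)] BD(1)[OF TB(3)] by auto
    have "max_forest_arcs G (T \<union> B) \<and> j \<in> root_set G (T \<union> B)"
      unfolding max_forest_arcs_root_iff[OF j] split using sub TB by blast
    moreover have "(j, i) \<in> (arc_to_ends G ` (T \<union> B))\<^sup>*"
      unfolding reachable_Un_iff[OF j TB(2) BD(1)[OF TB(3)]] using TB(3) by blast
    ultimately show "(case x of (T, B) \<Rightarrow> T \<union> B) \<in> ?S" using TB(1) by simp
    show "((case x of (T, B) \<Rightarrow> T \<union> B) \<inter> inner, (case x of (T, B) \<Rightarrow> T \<union> B) - inner) = x"
      using split TB(1) by simp
    have "T \<inter> B = {}" using TD(1)[OF TB(2)] BD(1)[OF TB(3)] by blast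
    thus "arcs_weight \<epsilon> G (case x of (T, B) \<Rightarrow> T \<union> B) =
        (case x of (T, B) \<Rightarrow> arcs_weight \<epsilon> G T * arcs_weight \<epsilon> G B)"
      using TD(2)[OF TB(2)] BD(2)[OF TB(3)] TB(1) by (simp add: arcs_weight_def prod.union_disjoint)
  next
    fix A assume A: "A \<in> ?S"
    hence "A \<subseteq> arcs G \<and> A \<inter> inner \<in> tree_arcs j \<and>
        max_forest_arcs (remove_inner_arcs G K) (A - inner)"
      unfolding max_forest_arcs_root_iff[OF j, symmetric] by blast
    hence R: "A \<inter> inner \<in> tree_arcs j" "max_forest_arcs (remove_inner_arcs G K) (A - inner)"
      "A - inner \<subseteq> arcs G - inner"
      by blast+
    have un: "(A \<inter> inner) \<union> (A - inner) = A" by blast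
    have "\<exists>k\<in>K. (k, i) \<in> (arc_to_ends G ` (A - inner))\<^sup>*"
      using reachable_Un_iff[OF j R(1) R(3), of i] A unfolding un by blast
    thus "(A \<inter> inner, A - inner) \<in> tree_arcs j \<times> ?P" using R by blast
    show "(case (A \<inter> inner, A - inner) of (T, B) \<Rightarrow> T \<union> B) = A" using un by simp
  qed
  finally show ?thesis by simp
qed

text \<open>Some tree of \<open>K\<close> completes \<open>B\<close> to a maximum forest of
  \<open>G\<close>. The root above \<open>i\<close> lies in a knot that reaches \<open>i\<close>,
  which can only be \<open>K\<close>; as \<open>j\<close> is the only root in \<open>K\<close>, it
  reaches \<open>i\<close>, and \<open>reachable_Un_iff\<close> returns this to
  \<open>B\<close>.\<close>

lemma outer_forest_reaches_knot_plus:
  assumes B: "max_forest_arcs (remove_inner_arcs G K) B" and i: "i \<in> knot_plus G K"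
  shows "\<exists>k\<in>K. (k, i) \<in> (arc_to_ends G ` B)\<^sup>*"
proof -
  obtain j T where jT: "j \<in> K" "T \<in> tree_arcs j" using exists_knot_tree by blast
  have Bs: "B \<subseteq> arcs G - inner" using B by (simp add: max_forest_arcs_def forest_arcs_remove)
  have Ts: "T \<subseteq> inner" using jT by (simp add: tree_arcs_def)
  let ?A = "T \<union> B"
  have split: "?A \<inter> inner = T" "?A - inner = B" using Ts Bs by blast+
  have sub: "?A \<subseteq> arcs G" using Ts Bs by auto
  have A: "max_forest_arcs G ?A" "j \<in> root_set G ?A"
    using max_forest_arcs_root_iff[OF jT(1), of ?A] sub jT B unfolding split by simp_all
  have FA: "forest_arcs G ?A" using A(1) by (simp add: max_forest_arcs_def)
  have iV: "i \<in> verts G" using i by (simp add: knot_plus_def)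
  then obtain r where r: "r \<in> root_set G ?A" "(r, i) \<in> (arc_to_ends G ` ?A)\<^sup>*"
    using exists_root_arcs[OF FA] by blast
  obtain L where L: "undominated_knot G L" "r \<in> L"
    using max_forest_root_in_knot[OF A(1) r(1)] by (auto simp: knot_union_def)
  have "r \<in> verts G" using r(1) by (simp add: root_set_def)
  hence "reachable G r i" using arc_rel_mono[OF sub r(2)] iV by (simp add: reachable_conv)
  hence "reachable_from_set G L i" using L(2) by (auto simp: reachable_from_set_def)
  hence "L = K" using i L(1) by (auto simp: knot_plus_def)
  hence "r \<in> root_set G ?A \<inter> K" "j \<in> root_set G ?A \<inter> K" using L(2) r(1) A(2) jT(1) by simp_all
  moreover obtain k where "root_set G ?A \<inter> K = {k}" using max_forest_root_in_K[OF A(1)] by blast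
  ultimately have "r = j" by simp
  thus ?thesis using r(2) by (simp add: reachable_Un_iff[OF jT Bs])
qed

text \<open>
  Replace the root of a maximum out forest in \<open>K\<close> by \<open>j\<close>.  Dropping the arcs that cross the
  boundary of the set reachable from \<open>j\<close> forces everything reachable from \<open>j\<close> into its tree.
\<close>

lemma exists_max_forest_from_to:
  assumes j: "j \<in> K" and i: "reachable G j i"
  shows "\<exists>A. max_forest_arcs G A \<and> j \<in> root_set G A \<and> (j, i) \<in> (arc_to_ends G ` A)\<^sup>*"
proof -
  obtain M where M: "max_forest_arcs G M" using exists_max_forest_arcs by blast
  hence FM: "forest_arcs G M" by (simp add: max_forest_arcs_def)
  obtain r where r: "r \<in> K" "root_set G M \<inter> K = {r}" using max_forest_root_in_K[OF M] by blast
  \<comment> \<open>Exchanging \<open>r\<close> for \<open>j\<close> keeps the number of roots, so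
    any forest with root set \<open>R\<close> is again maximum.\<close>
  define R where "R = insert j (root_set G M - {r})"
  define S where "S = {x. (j, x) \<in> (arcs_ends G)\<^sup>*}"
  define B where "B = {e \<in> arcs G. tail G e \<in> S \<longleftrightarrow> head G e \<in> S}"
  let ?EB = "arc_to_ends G ` B"
  have RV: "R \<subseteq> verts G" using j knot_subset by (auto simp: R_def root_set_def)
  have cardR: "card R = card (root_set G M)"
  proof -
    have fin: "finite (root_set G M)" by (simp add: root_set_def)
    have "r \<in> root_set G M" using r(2) by blast
    moreover have "j \<notin> root_set G M - {r}"
    proof
      assume "j \<in> root_set G M - {r}"
      hence "j \<in> root_set G M \<inter> K" "j \<noteq> r" using j by simp_all
      thus False unfolding r(2) by simp
    qed
    ultimately show ?thesis using fin card_Suc_Diff1[OF fin, of r] by (simp add: R_def)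
  qed
  \<comment> \<open>An old root reachable from \<open>j\<close> lies in a knot reached from
    \<open>K\<close>, hence in \<open>K\<close> itself, where \<open>r\<close> was the only
    root.\<close>
  have RS: "s = j" if "s \<in> R" "s \<in> S" for s
  proof (rule ccontr)
    assume "s \<noteq> j"
    hence s: "s \<in> root_set G M" "s \<noteq> r" using that by (auto simp: R_def)
    obtain L where L: "undominated_knot G L" "s \<in> L"
      using max_forest_root_in_knot[OF M s(1)] by (auto simp: knot_union_def)
    have "K = L" using knots_eq[OF knot L(1) j L(2)] that(2) by (simp add: S_def)
    hence "s \<in> root_set G M \<inter> K" using L(2) s(1) by simp
    thus False unfolding r(2) using s(2) by simp
  qed
  have S_step: "y \<in> S" if "x \<in> S" "(x, y) \<in> arcs_ends G" for x y
    using that unfolding S_def by (auto intro: rtrancl_into_rtrancl)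
  have B_arc: "(x, y) \<in> ?EB" if "(x, y) \<in> arcs_ends G" "x \<in> S \<longleftrightarrow> y \<in> S" for x y
    using that by (auto simp: B_def arcs_ends_def arc_to_ends_def)
  have inS: "(j, x) \<in> ?EB\<^sup>*" if "(j, x) \<in> (arcs_ends G)\<^sup>*" for x
    using that
  proof (induction rule: rtrancl_induct)
    case (step x y)
    have "x \<in> S" using step.hyps(1) by (simp add: S_def)
    hence "(x, y) \<in> ?EB" using B_arc step.hyps(2) S_step by blast
    thus ?case using step.IH by (rule rtrancl_into_rtrancl[rotated])
  qed simp
  \<comment> \<open>As \<open>S\<close> is closed under successors, a path ending outside
    \<open>S\<close> avoids it throughout and loses no arc when \<open>B\<close> replaces all
    arcs.\<close>
  have outS: "(s, x) \<in> ?EB\<^sup>*" if "(s, x) \<in> (arcs_ends G)\<^sup>*" "x \<notin> S" for s x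
    using that
  proof (induction rule: rtrancl_induct)
    case (step x y)
    have "x \<notin> S" using S_step step.hyps(2) step.prems by blast
    hence "(x, y) \<in> ?EB" using B_arc step.hyps(2) step.prems by blast
    thus ?case using step.IH[OF \<open>x \<notin> S\<close>] by (rule rtrancl_into_rtrancl[rotated])
  qed simp
  have reach: "\<exists>s\<in>R. (s, x) \<in> ?EB\<^sup>*" if x: "x \<in> verts G" for x
  proof (cases "x \<in> S")
    case True
    hence "(j, x) \<in> ?EB\<^sup>*" using inS by (simp add: S_def)
    thus ?thesis by (auto simp: R_def)
  next
    case False
    obtain s where s: "s \<in> root_set G M" "(s, x) \<in> (arcs_ends G)\<^sup>*"
      using exists_root_reaching[OF FM x] by (rule bexE)
    \<comment> \<open>If \<open>r\<close> reached \<open>x\<close>, so would \<open>j\<close>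
      through \<open>r\<close>, putting \<open>x\<close> into \<open>S\<close>.\<close>
    have "s \<noteq> r"
    proof
      assume "s = r"
      hence "(j, x) \<in> (arcs_ends G)\<^sup>*" using knot_mutual[OF knot j r(1)] s(2) by simp
      thus False using False by (simp add: S_def)
    qed
    hence "s \<in> R" using s(1) by (simp add: R_def)
    thus ?thesis using outS[OF s(2) False] by blast
  qed
  have BG: "B \<subseteq> arcs G" by (simp add: B_def)
  obtain A where A: "A \<subseteq> B" "forest_arcs G A" "root_set G A = R"
    using exists_forest_with_roots[OF BG RV reach] by blast
  have "card A = card M"
    using card_arcs_plus_card_root_set[OF A(2)] card_arcs_plus_card_root_set[OF FM] A(3) cardR
    by simp
  hence "max_forest_arcs G A" using M A(2) by (simp add: max_forest_arcs_def)
  moreover have "j \<in> root_set G A" using A(3) by (simp add: R_def)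
  moreover have "(j, i) \<in> (arc_to_ends G ` A)\<^sup>*"
  proof -
    have iV: "i \<in> verts G" and iS: "i \<in> S" using i by (simp_all add: S_def reachable_conv)
    obtain s where s: "s \<in> R" "(s, i) \<in> (arc_to_ends G ` A)\<^sup>*"
      using exists_root_arcs[OF A(2) iV] unfolding A(3) by (rule bexE)
    \<comment> \<open>No arc of \<open>B\<close> crosses the boundary of \<open>S\<close>, so
      tracing back from \<open>i\<close> stays in \<open>S\<close>; the root found there can only be
      \<open>j\<close>.\<close>
    have "x \<in> S" if "(x, i) \<in> (arc_to_ends G ` A)\<^sup>*" for x
      using that
    proof (induction rule: converse_rtrancl_induct)
      case base
      show ?case by (rule iS)
    next
      case (step x y)
      from step.hyps(1) obtain e where "e \<in> A" "x = tail G e" "y = head G e"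
        by (auto simp: arc_to_ends_def)
      thus ?case using step.IH A(1) by (auto simp: B_def)
    qed
    hence "s \<in> S" using s(2) by blast
    thus ?thesis using RS s by blast
  qed
  ultimately show ?thesis by blast
qed

end

section \<open>Weights\<close>

text \<open>Double counting: after the sums are exchanged, each \<open>A\<close> contributes for
  exactly one index. It serves both the row sums and the diagonal sum.\<close>

lemma sum_unique_partition:
  fixes f :: "'a \<Rightarrow> 'c::comm_monoid_add"
  assumes "finite S" "finite J" and uniq: "\<And>A. A \<in> S \<Longrightarrow> \<exists>!j. j \<in> J \<and> P A j"
  shows "(\<Sum>j\<in>J. \<Sum>A | A \<in> S \<and> P A j. f A) = (\<Sum>A\<in>S. f A)"
proof -
  have "(\<Sum>j\<in>J. \<Sum>A | A \<in> S \<and> P A j. f A) = (\<Sum>A\<in>S. \<Sum>j | j \<in> J \<and> P A j. f A)"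
    by (rule sum.swap_restrict[OF assms(2,1)])
  also have "\<dots> = (\<Sum>A\<in>S. f A)"
  proof (rule sum.cong[OF refl])
    fix A assume "A \<in> S"
    then obtain k where "{j. j \<in> J \<and> P A j} = {k}" using uniq[of A] by blast
    thus "(\<Sum>j | j \<in> J \<and> P A j. f A) = f A" by simp
  qed
  finally show ?thesis .
qed

section \<open>Row sums and support of the matrix\<close>

context digraph
begin

abbreviation max_arcs_number :: nat where
  "max_arcs_number \<equiv> card (verts G) - forest_dimension G"

lemma finite_max_forest_arcs: "finite {A. max_forest_arcs G A}"
  by (rule finite_subset[OF _ finite_forest_arcs]) (auto simp: max_forest_arcs_def)

lemma set_weight_forests:
  "set_weight \<epsilon> (forests G max_arcs_number) = (\<Sum>A | max_forest_arcs G A. arcs_weight \<epsilon> G A)"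
  unfolding forests_eq_maximum_out_forests maximum_out_forests_eq by (rule set_weight_image)

lemma forests_from_to_eq:
  assumes "i \<in> verts G"
  shows "forests_from_to G max_arcs_number j i = (\<lambda>A. G\<lparr>arcs := A\<rparr>) `
    {A. max_forest_arcs G A \<and> j \<in> root_set G A \<and> (j, i) \<in> (arc_to_ends G ` A)\<^sup>*}"
proof -
  have "in_tree_rooted_at (G\<lparr>arcs := A\<rparr>) j i \<longleftrightarrow>
      j \<in> root_set G A \<and> (j, i) \<in> (arc_to_ends G ` A)\<^sup>*" if "max_forest_arcs G A" for A
    using that assms in_tree_update[of A i j] by (simp add: max_forest_arcs_def)
  thus ?thesis
    unfolding forests_from_to_def forests_eq_maximum_out_forests maximum_out_forests_eq by auto
qed

lemma set_weight_forests_from_to: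
  assumes "i \<in> verts G"
  shows "set_weight \<epsilon> (forests_from_to G max_arcs_number j i) =
    (\<Sum>A | max_forest_arcs G A \<and> j \<in> root_set G A \<and> (j, i) \<in> (arc_to_ends G ` A)\<^sup>*. arcs_weight \<epsilon> G A)"
  unfolding forests_from_to_eq[OF assms] by (rule set_weight_image)

text \<open>In each maximum forest \<open>i\<close> belongs to exactly one tree, so the forest is
  counted in exactly one column.\<close>

lemma sum_forests_from_to:
  assumes i: "i \<in> verts G"
  shows "(\<Sum>j\<in>verts G. set_weight \<epsilon> (forests_from_to G max_arcs_number j i)) =
    set_weight \<epsilon> (forests G max_arcs_number)"
proof -
  let ?P = "\<lambda>A j. j \<in> root_set G A \<and> (j, i) \<in> (arc_to_ends G ` A)\<^sup>*"
  have "\<exists>!j. j \<in> verts G \<and> ?P A j" if "A \<in> {A. max_forest_arcs G A}" for A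
  proof -
    have FA: "forest_arcs G A" using that by (simp add: max_forest_arcs_def)
    obtain j where j: "j \<in> root_set G A" "(j, i) \<in> (arc_to_ends G ` A)\<^sup>*"
      using exists_root_arcs[OF FA i] by (rule bexE)
    have "k = j" if "?P A k" for k
      using root_unique_arcs[OF FA _ j(1) _ j(2)] that by simp
    thus ?thesis using j by (intro ex1I[of _ j]) (auto simp: root_set_def)
  qed
  from sum_unique_partition[OF finite_max_forest_arcs finite_verts this, where f = "arcs_weight \<epsilon> G"]
  show ?thesis
    unfolding set_weight_forests set_weight_forests_from_to[OF i] by simp
qed

lemma arcs_weight_pos:
  assumes "\<And>i j. (i, j) \<in> arcs_ends G \<Longrightarrow> \<epsilon> i j > 0" and "A \<subseteq> arcs G"
  shows "arcs_weight \<epsilon> G A > 0"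
  unfolding arcs_weight_def
proof (rule prod_pos)
  fix e assume "e \<in> A"
  thus "\<epsilon> (tail G e) (head G e) > 0" using assms by (auto simp: arcs_ends_conv)
qed

lemma sum_arcs_weight_pos:
  assumes "\<And>i j. (i, j) \<in> arcs_ends G \<Longrightarrow> \<epsilon> i j > 0"
    and "S \<subseteq> {A. forest_arcs G A}" "S \<noteq> {}"
  shows "(\<Sum>A\<in>S. arcs_weight \<epsilon> G A) > 0"
proof (rule sum_pos)
  show "finite S" using assms(2) finite_forest_arcs finite_subset by blast
  fix A assume "A \<in> S"
  hence "A \<subseteq> arcs G" using assms(2) by (auto simp: forest_arcs_def)
  thus "arcs_weight \<epsilon> G A > 0" using assms(1) by (intro arcs_weight_pos)
qed fact

text \<open>Positive weights cannot cancel, so the entry vanishes only if no forest contributes.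
  Roots of maximum forests lie in knots, and \<open>exists_max_forest_from_to\<close> supplies a
  forest for every admissible pair.\<close>

lemma forests_from_to_nonzero_iff:
  assumes pos: "\<And>i j. (i, j) \<in> arcs_ends G \<Longrightarrow> \<epsilon> i j > 0" and i: "i \<in> verts G"
  shows "set_weight \<epsilon> (forests_from_to G max_arcs_number j i) \<noteq> 0 \<longleftrightarrow>
    j \<in> knot_union G \<and> reachable G j i"
proof -
  define S where
    "S = {A. max_forest_arcs G A \<and> j \<in> root_set G A \<and> (j, i) \<in> (arc_to_ends G ` A)\<^sup>*}"
  have sub: "S \<subseteq> {A. forest_arcs G A}" by (auto simp: S_def max_forest_arcs_def)
  have "(\<Sum>A\<in>S. arcs_weight \<epsilon> G A) > 0" if "S \<noteq> {}"
    by (rule sum_arcs_weight_pos[OF pos sub that])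
  hence "(\<Sum>A\<in>S. arcs_weight \<epsilon> G A) \<noteq> 0 \<longleftrightarrow> S \<noteq> {}" by fastforce
  also have "S \<noteq> {} \<longleftrightarrow> j \<in> knot_union G \<and> reachable G j i"
  proof
    assume "S \<noteq> {}"
    then obtain A where A: "max_forest_arcs G A" "j \<in> root_set G A" "(j, i) \<in> (arc_to_ends G ` A)\<^sup>*"
      by (auto simp: S_def)
    have "A \<subseteq> arcs G" using A(1) by (simp add: max_forest_arcs_def forest_arcs_def)
    hence "(j, i) \<in> (arcs_ends G)\<^sup>*" using A(3) by (rule arc_rel_mono)
    moreover have "j \<in> verts G" using A(2) by (simp add: root_set_def)
    ultimately show "j \<in> knot_union G \<and> reachable G j i"
      using max_forest_root_in_knot[OF A(1,2)] i by (simp add: reachable_conv)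
  next
    assume R: "j \<in> knot_union G \<and> reachable G j i"
    then obtain K where K: "undominated_knot G K" "j \<in> K" by (auto simp: knot_union_def)
    interpret knot_digraph G K using K(1) by unfold_locales
    have "\<exists>A. A \<in> S" using exists_max_forest_from_to[of j i] K(2) R by (simp add: S_def)
    thus "S \<noteq> {}" by blast
  qed
  finally show ?thesis unfolding set_weight_forests_from_to[OF i] S_def .
qed

end

section \<open>The two factors and the diagonal over a knot\<close>

context knot_digraph
begin

lemma set_weight_knot_trees:
  "set_weight \<epsilon> (knot_trees_from G K j) = (\<Sum>T\<in>tree_arcs j. arcs_weight \<epsilon> G T)"
proof -
  interpret R: digraph "G \<restriction> K" by (rule digraph_restrict)
  have "diverging_tree ((G \<restriction> K)\<lparr>arcs := T\<rparr>) \<and> j \<in> roots ((G \<restriction> K)\<lparr>arcs := T\<rparr>) \<longleftrightarrow> T \<in> tree_arcs j"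
    if T: "T \<subseteq> inner" for T
  proof (cases "forest_arcs (G \<restriction> K) T")
    case True
    then interpret F: out_forest "(G \<restriction> K)\<lparr>arcs := T\<rparr>" by (rule R.out_forest_update)
    show ?thesis
      using F.diverging_tree_iff[of j] True
      by (simp add: R.roots_update[OF T] tree_arcs_def forest_arcs_restrict)
  next
    case False
    thus ?thesis
      using R.diverging_forest_update[OF T] T
      by (simp add: diverging_tree_def tree_arcs_def forest_arcs_restrict del: induce_subgraph_arcs)
  qed
  moreover have "T \<subseteq> inner" if "T \<in> tree_arcs j" for T
    using that by (simp add: tree_arcs_def)
  ultimately have "knot_trees_from G K j = (\<lambda>T. (G \<restriction> K)\<lparr>arcs := T\<rparr>) ` tree_arcs j"
    unfolding knot_trees_from_def R.spanning_iff by (auto simp del: induce_subgraph_arcs)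
  moreover have "arcs_weight \<epsilon> (G \<restriction> K) = arcs_weight \<epsilon> G"
    by (simp add: fun_eq_iff arcs_weight_def)
  ultimately show ?thesis using set_weight_image[of \<epsilon> "G \<restriction> K" "tree_arcs j"] by simp
qed

lemma arcs_weight_remove: "arcs_weight \<epsilon> (remove_inner_arcs G K) = arcs_weight \<epsilon> G"
  by (simp add: fun_eq_iff arcs_weight_def remove_inner_arcs_def)

lemma outer_forests_to_eq:
  assumes "i \<in> verts G"
  shows "outer_forests_to G K i = (\<lambda>B. (remove_inner_arcs G K)\<lparr>arcs := B\<rparr>) `
    {B. max_forest_arcs (remove_inner_arcs G K) B \<and> (\<exists>k\<in>K. (k, i) \<in> (arc_to_ends G ` B)\<^sup>*)}"
proof -
  interpret R: digraph "remove_inner_arcs G K" by (rule digraph_remove)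
  have "reachable_from_set ((remove_inner_arcs G K)\<lparr>arcs := B\<rparr>) K i \<longleftrightarrow>
      (\<exists>k\<in>K. (k, i) \<in> (arc_to_ends G ` B)\<^sup>*)"
    if "max_forest_arcs (remove_inner_arcs G K) B" for B
  proof -
    have "B \<subseteq> arcs (remove_inner_arcs G K)" using that by (simp add: max_forest_arcs_def forest_arcs_def)
    then interpret F: digraph "(remove_inner_arcs G K)\<lparr>arcs := B\<rparr>" by (rule R.digraph_update)
    have "reachable ((remove_inner_arcs G K)\<lparr>arcs := B\<rparr>) k i \<longleftrightarrow> (k, i) \<in> (arc_to_ends G ` B)\<^sup>*"
      if "k \<in> K" for k
    proof -
      have k: "k \<in> verts ((remove_inner_arcs G K)\<lparr>arcs := B\<rparr>)"
        using that knot_subset by (auto simp: remove_inner_arcs_def)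
      show ?thesis unfolding F.reachable_conv'[OF k] arcs_ends_update arc_to_ends_remove ..
    qed
    thus ?thesis by (simp add: reachable_from_set_def)
  qed
  thus ?thesis
    unfolding outer_forests_to_def outer_forests_def R.maximum_out_forests_eq by auto
qed

lemma set_weight_outer_forests_to:
  assumes "i \<in> verts G"
  shows "set_weight \<epsilon> (outer_forests_to G K i) =
    (\<Sum>B | max_forest_arcs (remove_inner_arcs G K) B \<and> (\<exists>k\<in>K. (k, i) \<in> (arc_to_ends G ` B)\<^sup>*).
      arcs_weight \<epsilon> G B)"
  unfolding outer_forests_to_eq[OF assms] by (simp add: set_weight_image arcs_weight_remove)

lemma outer_forests_to_knot_plus:
  assumes "i \<in> knot_plus G K"
  shows "outer_forests_to G K i = outer_forests G K"
proof -
  interpret R: digraph "remove_inner_arcs G K" by (rule digraph_remove)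
  have "i \<in> verts G" using assms by (simp add: knot_plus_def)
  moreover have "{B. max_forest_arcs (remove_inner_arcs G K) B \<and> (\<exists>k\<in>K. (k, i) \<in> (arc_to_ends G ` B)\<^sup>*)}
      = {B. max_forest_arcs (remove_inner_arcs G K) B}"
    using outer_forest_reaches_knot_plus[OF _ assms] by blast
  ultimately show ?thesis
    by (simp add: outer_forests_to_eq outer_forests_def R.maximum_out_forests_eq)
qed

text \<open>A knot that reaches a vertex of \<open>K\<close> equals \<open>K\<close> by
  \<open>knots_eq\<close>. This allows \<open>i = j\<close> in the formula for
  \<open>knot_plus\<close>, giving the diagonal entry.\<close>

lemma knot_subset_knot_plus: "K \<subseteq> knot_plus G K"
proof
  fix j assume j: "j \<in> K"
  hence "j \<in> verts G" using knot_subset by blast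
  moreover have "reachable_from_set G K j"
    using j \<open>j \<in> verts G\<close> by (auto simp: reachable_from_set_def)
  moreover have "L = K" if L: "undominated_knot G L" "reachable_from_set G L j" for L
  proof -
    obtain u where u: "u \<in> L" "reachable G u j" using L(2) by (auto simp: reachable_from_set_def)
    show ?thesis using knots_eq[OF L(1) knot u(1) j reachable_rtranclI[OF u(2)]] .
  qed
  ultimately show "j \<in> knot_plus G K" by (auto simp: knot_plus_def)
qed

lemma forests_from_to_factorization:
  assumes "j \<in> K" "i \<in> verts G"
  shows "set_weight \<epsilon> (forests_from_to G max_arcs_number j i) =
    set_weight \<epsilon> (knot_trees_from G K j) * set_weight \<epsilon> (outer_forests_to G K i)"
  unfolding set_weight_forests_from_to[OF assms(2)] set_weight_knot_trees
    set_weight_outer_forests_to[OF assms(2)]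
  by (rule sum_max_forest_arcs[OF assms(1)])

text \<open>On the diagonal the path condition is trivial, so the entry weighs all maximum forests
  rooted at \<open>j\<close>; each maximum forest has exactly one root in \<open>K\<close>.\<close>

lemma sum_forests_from_to_self:
  "(\<Sum>j\<in>K. set_weight \<epsilon> (forests_from_to G max_arcs_number j j)) =
    set_weight \<epsilon> (forests G max_arcs_number)"
proof -
  have "\<exists>!j. j \<in> K \<and> j \<in> root_set G A" if "A \<in> {A. max_forest_arcs G A}" for A
  proof -
    have "max_forest_arcs G A" using that by simp
    then obtain j where j: "root_set G A \<inter> K = {j}" using max_forest_root_in_K by blast
    have "k \<in> K \<and> k \<in> root_set G A \<longleftrightarrow> k = j" for k
      using j by (metis IntI IntD1 IntD2 singletonD singletonI)
    thus ?thesis by simp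
  qed
  from sum_unique_partition[OF finite_max_forest_arcs finite_knot this, where f = "arcs_weight \<epsilon> G"]
  have "(\<Sum>j\<in>K. \<Sum>A | max_forest_arcs G A \<and> j \<in> root_set G A. arcs_weight \<epsilon> G A) =
      set_weight \<epsilon> (forests G max_arcs_number)"
    unfolding set_weight_forests by simp
  moreover have "set_weight \<epsilon> (forests_from_to G max_arcs_number j j) =
      (\<Sum>A | max_forest_arcs G A \<and> j \<in> root_set G A. arcs_weight \<epsilon> G A)" if "j \<in> K" for j
    using that knot_subset by (simp add: set_weight_forests_from_to subset_iff)
  ultimately show ?thesis by simp
qed

text \<open>Ensures that the quotient of tree weights in the column relation has a nonzero
  denominator.\<close>

lemma knot_trees_weight_pos:
  assumes "\<And>i j. (i, j) \<in> arcs_ends G \<Longrightarrow> \<epsilon> i j > 0" and "j \<in> K"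
  shows "set_weight \<epsilon> (knot_trees_from G K j) > 0"
proof -
  have "tree_arcs j \<subseteq> {A. forest_arcs G A}" by (auto simp: tree_arcs_def)
  moreover have "tree_arcs j \<noteq> {}" using exists_tree[OF assms(2)] by blast
  ultimately show ?thesis
    unfolding set_weight_knot_trees using assms(1) by (intro sum_arcs_weight_pos)
qed

end

theorem theorem2:
  fixes G :: "('n::finite, 'b) pre_digraph"
    and \<epsilon> :: "'n \<Rightarrow> 'n \<Rightarrow> real"
    and n v :: nat
    and K :: "'n set"
    and Q :: "real ^ 'n ^ 'n"
  assumes "digraph G"
    and "verts G = UNIV"
    and "n = CARD('n)"
    and "n > 1"
    and "\<And>i j. (i, j) \<in> arcs_ends G \<Longrightarrow> \<epsilon> i j > 0"
    and "v = forest_dimension G"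
    and "undominated_knot G K"
    and "Q = forest_matrix \<epsilon> G (n - v)"
  shows
    "(\<forall>i. (\<Sum>j\<in>UNIV. Q $ i $ j) = set_weight \<epsilon> (forests G (n - v)))
     \<and> (\<forall>i j. Q $ i $ j \<noteq> 0 \<longleftrightarrow> j \<in> knot_union G \<and> reachable G j i)
     \<and> (\<forall>j\<in>K.
          (\<forall>i. Q $ i $ j
                = set_weight \<epsilon> (knot_trees_from G K j) * set_weight \<epsilon> (outer_forests_to G K i))
          \<and> (\<forall>i\<in>knot_plus G K.
                Q $ i $ j = Q $ j $ j
                \<and> Q $ j $ j
                   = set_weight \<epsilon> (knot_trees_from G K j) * set_weight \<epsilon> (outer_forests G K)))
     \<and> ((\<Sum>j\<in>K. Q $ j $ j) = set_weight \<epsilon> (forests G (n - v))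
        \<and> (\<forall>j. undominated G j \<longrightarrow> Q $ j $ j = set_weight \<epsilon> (forests G (n - v))))
     \<and> (\<forall>j1\<in>K. \<forall>j2\<in>K.
          column j2 Q
          = (set_weight \<epsilon> (knot_trees_from G K j2) / set_weight \<epsilon> (knot_trees_from G K j1))
            *s column j1 Q)"
proof -
  interpret digraph G by fact
  interpret knot_digraph G K using assms(7) by unfold_locales
  have num: "n - v = max_arcs_number" using assms(2,3,6) by simp
  have V: "i \<in> verts G" for i using assms(2) by simp
  have Q: "Q $ i $ j = set_weight \<epsilon> (forests_from_to G max_arcs_number j i)" for i j
    unfolding assms(8) num by (simp add: forest_matrix_def)
  have fact: "Q $ i $ j =
      set_weight \<epsilon> (knot_trees_from G K j) * set_weight \<epsilon> (outer_forests_to G K i)"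
    if "j \<in> K" for i j
    unfolding Q using that V by (rule forests_from_to_factorization)
  have plus: "Q $ i $ j =
      set_weight \<epsilon> (knot_trees_from G K j) * set_weight \<epsilon> (outer_forests G K)"
    if "j \<in> K" "i \<in> knot_plus G K" for i j
    using fact[OF that(1)] outer_forests_to_knot_plus[OF that(2)] by simp
  have undom: "Q $ j $ j = set_weight \<epsilon> (forests G (n - v))" if "undominated G j" for j
  proof -
    \<comment> \<open>An undominated vertex is a knot by itself, and the diagonal sum over that knot
      has a single term.\<close>
    interpret J: knot_digraph G "{j}"
      using undominated_singleton_knot[OF that] by unfold_locales
    show ?thesis using J.sum_forests_from_to_self[of \<epsilon>] unfolding Q num by simp
  qed
  have col: "column j2 Q =
      (set_weight \<epsilon> (knot_trees_from G K j2) / set_weight \<epsilon> (knot_trees_from G K j1)) *s column j1 Q"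
    if "j1 \<in> K" "j2 \<in> K" for j1 j2
  proof -
    have "set_weight \<epsilon> (knot_trees_from G K j1) > 0"
      using assms(5) that(1) by (rule knot_trees_weight_pos)
    thus ?thesis
      by (simp add: vec_eq_iff column_def fact[OF that(1)] fact[OF that(2)])
  qed
  have rows: "(\<Sum>j\<in>UNIV. Q $ i $ j) = set_weight \<epsilon> (forests G (n - v))" for i
    using sum_forests_from_to[OF V] unfolding Q num assms(2) .
  have nonzero: "Q $ i $ j \<noteq> 0 \<longleftrightarrow> j \<in> knot_union G \<and> reachable G j i" for i j
    unfolding Q using assms(5) V by (rule forests_from_to_nonzero_iff)
  have diag: "(\<Sum>j\<in>K. Q $ j $ j) = set_weight \<epsilon> (forests G (n - v))"
    unfolding Q num by (rule sum_forests_from_to_self)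
  have plus_diag: "Q $ j $ j =
      set_weight \<epsilon> (knot_trees_from G K j) * set_weight \<epsilon> (outer_forests G K)"
    if "j \<in> K" for j
    using plus[OF that] knot_subset_knot_plus that by blast
  have const: "Q $ i $ j = Q $ j $ j" if "j \<in> K" "i \<in> knot_plus G K" for i j
    unfolding plus[OF that] plus_diag[OF that(1)] ..
  show ?thesis
    by (intro conjI allI ballI impI rows nonzero fact const plus_diag diag undom col) assumption+
qed

end
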